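(* Let $M$ be a nonempty compact convex set of width $w$ in $\mathbb{R}^n$ and let $\boldsymbol{x}_1,\dots,\boldsymbol{x}_k$ be points in $M$. Let $S$ be the collection of all planks $P$ in $\mathbb{R}^n$ with both bounding hyperplanes intersecting $M$ and such that the interior of $P$ does not contain any point $\boldsymbol{x}_i$, $1 \leq i \leq k$. For each such plank write $h(P)$ for its width, and define $$H := \sup_{P \in S} h(P).$$ Then $$H \geq \begin{cases} \dfrac{w}{k-n+2} & \text{if } k \geq n, \\[2mm] \dfrac{w}{2} & \text{if } k < n. \end{cases}$$
   Context: The width $w(M)$ of a nonempty convex compact set $M \subset \mathbb{R}^n$ is the smallest distance between two parallel supporting hyperplanes to $M$ (with $M$ lying between them). A plank $P$ in $\mathbb{R}^n$ is a strip of space between two parallel (affine, $(n-1)$-dimensional) hyperplanes, called its bounding hyperplanes; its width $h(P)$ is the distance between them. *)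

theory Defs
  imports "HOL-Analysis.Analysis"
begin

(* P is the closed strip with bounding hyperplanes A and B. The case b = c is
   permitted: P is then a single hyperplane, its interior is empty and its width is 0. *)
definition plank :: "'a::euclidean_space set \<Rightarrow> 'a set \<Rightarrow> 'a set \<Rightarrow> bool" where
  "plank P A B \<longleftrightarrow>
     (\<exists>u b c. u \<noteq> 0 \<and> b \<le> c \<and> A = {y. u \<bullet> y = b} \<and> B = {y. u \<bullet> y = c} \<and>
        P = {y. b \<le> u \<bullet> y \<and> u \<bullet> y \<le> c})"

definition supporting_hyperplane :: "'a::euclidean_space set \<Rightarrow> 'a set \<Rightarrow> bool" where
  "supporting_hyperplane A M \<longleftrightarrow>
     (\<exists>u b. u \<noteq> 0 \<and> A = {y. u \<bullet> y = b} \<and> A \<inter> M \<noteq> {} \<and> M \<subseteq> {y. u \<bullet> y \<le> b})"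

(* The two supporting hyperplanes may coincide, so a set contained in a hyperplane
   has width 0. *)
definition convex_width :: "'a::euclidean_space set \<Rightarrow> real" where
  "convex_width M =
     Inf {setdist A B | A B. \<exists>P. plank P A B \<and> M \<subseteq> P \<and>
        supporting_hyperplane A M \<and> supporting_hyperplane B M}"

(* A plank is carried along with its bounding hyperplanes. A degenerate plank
   contributes only the value 0 to the supremum of the widths; it is needed when M is a
   single point, where no other plank is available and the supremum of the empty set of
   reals would be meaningless. *)
definition free_planks ::
    "'a::euclidean_space set \<Rightarrow> 'a set \<Rightarrow> ('a set \<times> 'a set \<times> 'a set) set" where
  "free_planks M X =
     {(P, A, B). plank P A B \<and> A \<inter> M \<noteq> {} \<and> B \<inter> M \<noteq> {} \<and> interior P \<inter> X = {}}"

definition plank_width :: "'a::euclidean_space set \<times> 'a set \<times> 'a set \<Rightarrow> real" where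
  "plank_width = (\<lambda>(P, A, B). setdist A B)"

lemma setdist_parallel_hyperplanes:
  fixes u :: "'a::euclidean_space"
  assumes "u \<noteq> 0"
  shows "setdist {y. u \<bullet> y = b} {y. u \<bullet> y = c} = \<bar>c - b\<bar> / norm u"
proof (rule antisym)
  define p where "p = (b / (u \<bullet> u)) *\<^sub>R u"
  define q where "q = (c / (u \<bullet> u)) *\<^sub>R u"
  have uu: "u \<bullet> u \<noteq> 0" using assms by simp
  have p: "u \<bullet> p = b" and q: "u \<bullet> q = c" using uu by (simp_all add: p_def q_def)
  have "p - q = ((b - c) / (u \<bullet> u)) *\<^sub>R u"
    by (simp add: p_def q_def diff_divide_distrib scaleR_diff_left)
  then have "dist p q = \<bar>c - b\<bar> / norm u"
    using assms by (simp add: dist_norm dot_square_norm power2_eq_square abs_minus_commute)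
  then show "setdist {y. u \<bullet> y = b} {y. u \<bullet> y = c} \<le> \<bar>c - b\<bar> / norm u"
    using setdist_le_dist[of p "{y. u \<bullet> y = b}" q "{y. u \<bullet> y = c}"] p q by simp
  show "\<bar>c - b\<bar> / norm u \<le> setdist {y. u \<bullet> y = b} {y. u \<bullet> y = c}"
  proof (rule le_setdistI)
    show "{y. u \<bullet> y = b} \<noteq> {}" "{y. u \<bullet> y = c} \<noteq> {}" using p q by blast+
    fix x y assume "x \<in> {y. u \<bullet> y = b}" "y \<in> {y. u \<bullet> y = c}"
    then have "\<bar>c - b\<bar> = \<bar>u \<bullet> (y - x)\<bar>" by (simp add: inner_diff_right)
    also have "\<dots> \<le> norm u * dist x y"
      using Cauchy_Schwarz_ineq2[of u "y - x"] by (simp add: dist_norm norm_minus_commute)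
    finally show "\<bar>c - b\<bar> / norm u \<le> dist x y"
      using assms by (simp add: divide_le_eq mult.commute)
  qed
qed

lemma bdd_above_plank_width:
  assumes "bounded M"
  shows "bdd_above (plank_width ` free_planks M X)"
proof (rule bdd_aboveI2)
  fix T assume "T \<in> free_planks M X"
  then have "\<exists>P A B. T = (P, A, B) \<and> A \<inter> M \<noteq> {} \<and> B \<inter> M \<noteq> {}"
    unfolding free_planks_def by blast
  then obtain P A B p q where T: "T = (P, A, B)" "p \<in> A" "p \<in> M" "q \<in> B" "q \<in> M"
    by blast
  then show "plank_width T \<le> diameter M"
    using setdist_le_dist[of p A q B] diameter_bounded_bound[OF assms, of p q]
    by (simp add: plank_width_def)
qed

lemma free_planks_nonempty:
  assumes "M \<noteq> {}"
  shows "free_planks M X \<noteq> {}"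
proof -
  obtain p where p: "p \<in> M" using assms by blast
  obtain u :: 'a where u: "u \<in> Basis" using nonempty_Basis by blast
  let ?A = "{y. u \<bullet> y = u \<bullet> p}"
  have u0: "u \<noteq> 0" using u by auto
  have "plank ?A ?A ?A"
    unfolding plank_def
    by (rule exI[of _ u], rule exI[of _ "u \<bullet> p"], rule exI[of _ "u \<bullet> p"]) (use u0 in auto)
  moreover have "interior ?A = {}" using u0 by (simp add: interior_hyperplane)
  ultimately have "(?A, ?A, ?A) \<in> free_planks M X" using p by (auto simp: free_planks_def)
  then show ?thesis by blast
qed

end

(* Some hyperplane u \<bullet> y = const contains min(n, k) of the points, so projecting along u leaves at
   most max(1, k - n + 1) distinct values in the interval that is the image of M. These cut the
   interval into at most max(2, k - n + 2) pieces; the longest piece is the projection of the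
   required plank. *)
theory Submission
  imports Defs
begin

text \<open>Pigeonhole: \<open>m + 1\<close> pairwise disjoint open intervals of equal length fit
  into \<open>[a, b]\<close>, and at most \<open>m\<close> points cannot meet all of them. If
  \<open>a = b\<close>, the intervals are empty.\<close>

lemma exists_large_gap:
  fixes F :: "real set"
  assumes "finite F" "card F \<le> m" "a \<le> b"
  obtains s t where "a \<le> s" "s \<le> t" "t \<le> b" "t - s = (b - a) / real (Suc m)" "{s<..<t} \<inter> F = {}"
proof -
  define d where "d = (b - a) / real (Suc m)"
  have d0: "d \<ge> 0" using assms(3) by (simp add: d_def)
  have b: "b = a + real (Suc m) * d" by (simp add: d_def del: of_nat_Suc)
  define I where "I = (\<lambda>j::nat. {a + real j * d<..<a + real (Suc j) * d})"
  have "\<exists>j\<le>m. I j \<inter> F = {}"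
  proof (rule ccontr)
    assume "\<not> (\<exists>j\<le>m. I j \<inter> F = {})"
    then have "\<forall>j\<in>{..m}. \<exists>f. f \<in> I j \<and> f \<in> F" by auto
    then obtain f where f: "\<And>j. j \<le> m \<Longrightarrow> f j \<in> I j \<and> f j \<in> F"
      unfolding bchoice_iff by auto
    \<comment> \<open>The right end of \<open>I i\<close> is at most the left end of
      \<open>I j\<close>, so the chosen points are distinct.\<close>
    have less: "f i < f j" if "i < j" "j \<le> m" for i j
    proof -
      have "real (Suc i) * d \<le> real j * d" using that d0 by (intro mult_right_mono) auto
      then show ?thesis using f[of i] f[of j] that by (auto simp: I_def)
    qed
    have "inj_on f {..m}"
      by (rule linorder_inj_onI) (use less in \<open>force+\<close>)
    moreover have "f ` {..m} \<subseteq> F" using f by auto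
    ultimately have "card {..m} \<le> card F" using assms(1) card_inj_on_le by blast
    then show False using assms(2) by simp
  qed
  then obtain j where j: "j \<le> m" "I j \<inter> F = {}" by blast
  show thesis
  proof (rule that[of "a + real j * d" "a + real (Suc j) * d"])
    have "real (Suc j) * d \<le> real (Suc m) * d" using j d0 by (intro mult_right_mono) auto
    then show "a + real (Suc j) * d \<le> b" using b by simp
    show "a + real (Suc j) * d - (a + real j * d) = (b - a) / real (Suc m)"
      unfolding d_def[symmetric] by (simp add: algebra_simps)
  qed (use j d0 in \<open>auto simp: I_def algebra_simps\<close>)
qed

text \<open>At most \<open>DIM('a)\<close> points always lie on a common hyperplane; along its
  normal they all take one value. Subtraction is truncated, so \<open>max 1\<close> covers small
  \<open>X\<close>.\<close>

lemma exists_direction_few_values: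
  fixes X :: "'a::euclidean_space set"
  assumes "finite X"
  obtains u where "u \<noteq> 0" "card ((\<bullet>) u ` X) \<le> max 1 (card X + 1 - DIM('a))"
proof -
  obtain Y where Y: "Y \<subseteq> X" "card Y = min (card X) DIM('a)"
    using obtain_subset_with_card_n[of "min (card X) DIM('a)" X] by auto
  have finY: "finite Y" using Y assms finite_subset by blast
  have "aff_dim Y < DIM('a)" using aff_dim_le_card[OF finY] Y(2) by linarith
  then obtain u b where u: "u \<noteq> 0" "Y \<subseteq> {y. u \<bullet> y = b}"
    using aff_lowdim_subset_hyperplane by blast
  \<comment> \<open>All of \<open>Y\<close> contributes only \<open>b\<close>; each remaining point
    adds at most one value.\<close>
  have "(\<bullet>) u ` X \<subseteq> insert b ((\<bullet>) u ` (X - Y))" using u(2) by auto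
  then have "card ((\<bullet>) u ` X) \<le> card (insert b ((\<bullet>) u ` (X - Y)))"
    using assms by (intro card_mono) auto
  also have "\<dots> \<le> Suc (card ((\<bullet>) u ` (X - Y)))" by (rule card_insert_le_m1) auto
  also have "\<dots> \<le> Suc (card (X - Y))" using assms card_image_le[of "X - Y"] by simp
  also have "\<dots> = Suc (card X - card Y)" using Y finY by (simp add: card_Diff_subset)
  also have "\<dots> \<le> max 1 (card X + 1 - DIM('a))" using Y(2) by linarith
  finally show thesis using that u(1) by blast
qed

text \<open>The level hyperplanes through the extremal points \<open>p\<close> and \<open>q\<close>
  support \<open>M\<close> and enclose it, so their distance competes in the infimum.\<close>

lemma convex_width_le:
  fixes M :: "'a::euclidean_space set"
  assumes "u \<noteq> 0" "p \<in> M" "q \<in> M" and M: "\<And>y. y \<in> M \<Longrightarrow> u \<bullet> p \<le> u \<bullet> y \<and> u \<bullet> y \<le> u \<bullet> q"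
  shows "convex_width M \<le> (u \<bullet> q - u \<bullet> p) / norm u"
proof -
  let ?A = "{y. u \<bullet> y = u \<bullet> p}" and ?B = "{y. u \<bullet> y = u \<bullet> q}"
  let ?P = "{y. u \<bullet> p \<le> u \<bullet> y \<and> u \<bullet> y \<le> u \<bullet> q}"
  let ?W = "{setdist A B | A B. \<exists>P. plank P A B \<and> M \<subseteq> P \<and>
        supporting_hyperplane A M \<and> supporting_hyperplane B M}"
  have pq: "u \<bullet> p \<le> u \<bullet> q" using M assms by blast
  then have "plank ?P ?A ?B" using assms(1) unfolding plank_def by blast
  \<comment> \<open>\<open>M\<close> lies above \<open>?A\<close>, whereas the definition wants it
    below, hence the reversed normal \<open>-u\<close>.\<close>
  moreover have "supporting_hyperplane ?A M"
    unfolding supporting_hyperplane_def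
    by (rule exI[of _ "-u"], rule exI[of _ "- (u \<bullet> p)"]) (use assms in auto)
  moreover have "supporting_hyperplane ?B M"
    unfolding supporting_hyperplane_def
    by (rule exI[of _ u], rule exI[of _ "u \<bullet> q"]) (use assms in auto)
  moreover have "M \<subseteq> ?P" using M by blast
  ultimately have "setdist ?A ?B \<in> ?W" by blast
  moreover have "bdd_below ?W" by (rule bdd_belowI[of _ 0]) (auto simp: setdist_pos_le)
  ultimately have "convex_width M \<le> setdist ?A ?B"
    unfolding convex_width_def by (rule cInf_lower)
  then show ?thesis using pq by (simp add: setdist_parallel_hyperplanes[OF assms(1)])
qed

text \<open>A gap between the values of \<open>X\<close> in the interval
  \<open>[u \<bullet> p, u \<bullet> q]\<close>, the image of \<open>M\<close>, pulls back to a free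
  plank; dividing its length by \<open>norm u\<close> gives the width.\<close>

lemma exists_wide_free_plank:
  fixes M :: "'a::euclidean_space set"
  assumes M: "M \<noteq> {}" "compact M" "convex M"
    and u: "u \<noteq> 0" and X: "finite X" "card ((\<bullet>) u ` X) \<le> m"
  obtains T where "T \<in> free_planks M X" "plank_width T \<ge> convex_width M / real (Suc m)"
proof -
  have cont: "continuous_on M ((\<bullet>) u)" by (intro continuous_intros)
  obtain p where p: "p \<in> M" "\<And>y. y \<in> M \<Longrightarrow> u \<bullet> p \<le> u \<bullet> y"
    using continuous_attains_inf[OF M(2,1) cont] by blast
  obtain q where q: "q \<in> M" "\<And>y. y \<in> M \<Longrightarrow> u \<bullet> y \<le> u \<bullet> q"
    using continuous_attains_sup[OF M(2,1) cont] by blast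
  obtain s t where st: "u \<bullet> p \<le> s" "s \<le> t" "t \<le> u \<bullet> q"
      "t - s = (u \<bullet> q - u \<bullet> p) / real (Suc m)" "{s<..<t} \<inter> (\<bullet>) u ` X = {}"
    using exists_large_gap[OF finite_imageI[OF X(1)] X(2) p(2)[OF q(1)]] by blast
  let ?A = "{y. u \<bullet> y = s}" and ?B = "{y. u \<bullet> y = t}" and ?P = "{y. s \<le> u \<bullet> y \<and> u \<bullet> y \<le> t}"
  \<comment> \<open>Convexity enters through connectedness: every intermediate value is attained on
    \<open>M\<close>.\<close>
  have hits: "{y. u \<bullet> y = r} \<inter> M \<noteq> {}" if "u \<bullet> p \<le> r" "r \<le> u \<bullet> q" for r
    using connected_ivt_hyperplane[OF convex_connected[OF M(3)] p(1) q(1) that] by blast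
  have "plank ?P ?A ?B" using u st(2) unfolding plank_def by blast
  moreover have "?A \<inter> M \<noteq> {}" "?B \<inter> M \<noteq> {}" using st by (intro hits; linarith)+
  moreover have "interior ?P \<inter> X = {}"
  proof -
    \<comment> \<open>As an intersection of two half-spaces, \<open>?P\<close> has the open strip as
      interior, and a point of \<open>X\<close> there would have its value in the gap.\<close>
    have "?P = {y. u \<bullet> y \<ge> s} \<inter> {y. u \<bullet> y \<le> t}" by auto
    then have "interior ?P = {y. s < u \<bullet> y} \<inter> {y. u \<bullet> y < t}"
      using u by simp
    then show ?thesis using st(5) by auto
  qed
  ultimately have "(?P, ?A, ?B) \<in> free_planks M X" by (simp add: free_planks_def)
  moreover have "plank_width (?P, ?A, ?B) = (u \<bullet> q - u \<bullet> p) / norm u / real (Suc m)"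
    using st(2) by (simp add: plank_width_def setdist_parallel_hyperplanes[OF u] abs_of_nonneg st(4)[symmetric])
      (simp add: st(4))
  ultimately show thesis
    using that convex_width_le[OF u p(1) q(1)] p(2) q(2)
    by (metis (no_types, lifting) divide_right_mono of_nat_0_le_iff)
qed

theorem proposition4p1:
  fixes M :: "'a::euclidean_space set" and x :: "nat \<Rightarrow> 'a" and k :: nat and w H :: real
  assumes "M \<noteq> {}" and "compact M" and "convex M"
    and "w = convex_width M"
    and "\<And>i. i \<in> {1..k} \<Longrightarrow> x i \<in> M"
    and "H = (SUP P \<in> free_planks M (x ` {1..k}). plank_width P)"
  shows "H \<ge> (if k \<ge> DIM('a) then w / (real k - real DIM('a) + 2) else w / 2)"
proof -
  let ?X = "x ` {1..k}"
  let ?m = "max 1 (k + 1 - DIM('a))"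
  obtain u where u: "u \<noteq> 0" "card ((\<bullet>) u ` ?X) \<le> max 1 (card ?X + 1 - DIM('a))"
    using exists_direction_few_values[of ?X] by auto
  \<comment> \<open>The points \<open>x i\<close> may coincide, which only lowers the number of
    values.\<close>
  have "card ?X \<le> k" using card_image_le[of "{1..k}" x] by simp
  then have "card ((\<bullet>) u ` ?X) \<le> ?m" using u(2) by linarith
  then obtain T where T: "T \<in> free_planks M ?X" "plank_width T \<ge> w / real (Suc ?m)"
    using exists_wide_free_plank[OF assms(1-3) u(1), of ?X ?m] assms(4) by blast
  have "plank_width T \<le> H"
    unfolding assms(6)
    using T(1) bdd_above_plank_width[OF compact_imp_bounded[OF assms(2)]] by (rule cSUP_upper)
  \<comment> \<open>For \<open>k < DIM('a)\<close> the natural subtraction in \<open>?m\<close>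
    gives 0, so \<open>?m = 1\<close> and the denominator is 2.\<close>
  moreover have "real (Suc ?m) = (if k \<ge> DIM('a) then real k - real DIM('a) + 2 else 2)"
    by (auto simp: max_def of_nat_diff)
  ultimately show ?thesis using T(2) by (auto split: if_splits)
qed

end
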